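(* Let $0<\lambda<1$. For each $i=1,\dots,k$ let $V_{i}:=\max\{\lambda p_{ij}+(1-\lambda)(-c_{ij}) : 1\le j\le n_{i}\}$, let $j_{i}^{*}\in\{1,\dots,n_{i}\}$ be an index at which this maximum is attained, i.e. $V_{i}=\lambda p_{ij_{i}^{*}}+(1-\lambda)(-c_{ij_{i}^{*}})$, and let $\bar{x}^{i}:=(0,\dots,0,1,0,\dots,0)\in\mathbb{R}^{n_{i}}$ be the vector with $1$ in position $j_{i}^{*}$ and $0$ elsewhere. Then, for any such choice of the indices $j_i^*$: (a) for each $i=1,\dots,k$, $\bar{x}^{i}$ solves the problem $$(BS(\lambda))_{i}\qquad \max_{x^{i}\in X^{i}}\ [\lambda (p^{i})^{T}x^{i}+(1-\lambda)(-c^{i})^{T}x^{i}];$$ (b) $\bar{x}^{*}:=(\bar{x}^{1},\bar{x}^{2},\dots,\bar{x}^{k})^{T}\in\mathbb{R}^{n}$ solves the problem $$(BS(\lambda))\qquad \max_{x\in X}\ \lambda p^{T}x+(1-\lambda)(-c)^{T}x.$$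
   Context: Let $k\ge 1$ and $n_{1},\dots,n_{k}\ge 1$ be integers, $n=\sum_{i=1}^{k}n_{i}$. Vectors $x\in\mathbb{R}^{n}$ are indexed as $x=(x_{ij})$, $i=1,\dots,k$, $j=1,\dots,n_{i}$, and split into blocks $x=(x^{1},\dots,x^{k})^{T}$ with $x^{i}=(x_{i1},\dots,x_{in_{i}})\in\mathbb{R}^{n_{i}}$. The vectors $p=(p_{ij})=(p^{1},\dots,p^{k})^{T}$ and $c=(c_{ij})=(c^{1},\dots,c^{k})^{T}$ in $\mathbb{R}^{n}$ have real nonnegative entries and are split in the same way. $u^{T}v$ denotes the usual scalar product. $X^{i}:=\{x^{i}\in\mathbb{R}^{n_{i}} : \sum_{j=1}^{n_{i}}x_{ij}=1,\ x_{ij}\in\{0,1\},\ j=1,\dots,n_{i}\}$ for $i=1,\dots,k$, and $X:=X^{1}\times\dots\times X^{k}$. A point solves a maximization problem if it belongs to the feasible set and attains the maximum of the objective over it. *)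

theory Defs
  imports Complex_Main "HOL-Library.FuncSet"
begin

text \<open>
  The block sizes vary with the block index, so \<open>\<real>\<^sup>m\<close> is the set of functions extensional on
  \<open>{1..m}\<close>, and \<open>\<real>\<^sup>n = \<real>\<^bsup>n 1\<^esup> \<times> \<dots> \<times> \<real>\<^bsup>n k\<^esup>\<close> is an extensional dependent product of such sets:
  the block \<open>x\<^sup>i\<close> is \<open>x i\<close> and the entry \<open>x\<^sub>i\<^sub>j\<close> is \<open>x i j\<close>.
\<close>

definition vecs :: "nat \<Rightarrow> (nat \<Rightarrow> real) set" where
  "vecs m = {1..m} \<rightarrow>\<^sub>E UNIV"

definition block_vecs :: "nat \<Rightarrow> (nat \<Rightarrow> nat) \<Rightarrow> (nat \<Rightarrow> nat \<Rightarrow> real) set" where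
  "block_vecs k n = (\<Pi>\<^sub>E i\<in>{1..k}. vecs (n i))"

text \<open>
  The scalar products read only the entries inside the index range. Hence \<open>-u\<close> may be formed
  with the pointwise negation of functions, although it changes the value \<open>undefined\<close> that
  extensional functions take outside that range.
\<close>

definition dot :: "nat \<Rightarrow> (nat \<Rightarrow> real) \<Rightarrow> (nat \<Rightarrow> real) \<Rightarrow> real" where
  "dot m u v = (\<Sum>j\<in>{1..m}. u j * v j)"

definition block_dot ::
    "nat \<Rightarrow> (nat \<Rightarrow> nat) \<Rightarrow> (nat \<Rightarrow> nat \<Rightarrow> real) \<Rightarrow> (nat \<Rightarrow> nat \<Rightarrow> real) \<Rightarrow> real" where
  "block_dot k n u v = (\<Sum>i\<in>{1..k}. \<Sum>j\<in>{1..n i}. u i j * v i j)"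

definition choice_set :: "nat \<Rightarrow> (nat \<Rightarrow> real) set" where
  "choice_set m = {x \<in> vecs m. (\<Sum>j\<in>{1..m}. x j) = 1 \<and> (\<forall>j\<in>{1..m}. x j \<in> {0, 1})}"

definition feasible_set :: "nat \<Rightarrow> (nat \<Rightarrow> nat) \<Rightarrow> (nat \<Rightarrow> nat \<Rightarrow> real) set" where
  "feasible_set k n = (\<Pi>\<^sub>E i\<in>{1..k}. choice_set (n i))"

definition unit_vec :: "nat \<Rightarrow> nat \<Rightarrow> nat \<Rightarrow> real" where
  "unit_vec m j = (\<lambda>l\<in>{1..m}. if l = j then 1 else 0)"

definition solves_max :: "('a \<Rightarrow> real) \<Rightarrow> 'a set \<Rightarrow> 'a \<Rightarrow> bool" where
  "solves_max f S x \<longleftrightarrow> is_arg_max f (\<lambda>y. y \<in> S) x"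

end

theory Submission
  imports Defs
begin

text \<open>
  On \<open>X\<^sup>i\<close> the objective is a convex combination of the block's coefficients, hence at most the
  largest of them, and a unit vector picks out a single coefficient. The objective on \<open>X\<close> is a sum
  of functions of one block each and \<open>X\<close> is a product, so it is maximized blockwise.
\<close>

lemma solves_max_iff: "solves_max f S x \<longleftrightarrow> x \<in> S \<and> (\<forall>y\<in>S. f y \<le> f x)"
  by (auto simp: solves_max_def is_arg_max_linorder)

text \<open>Membership in the product constrains each block separately, so the blockwise bounds can
  be added term by term. \<open>restrict\<close> is there because elements of the product must be
  \<open>undefined\<close> outside \<open>I\<close>.\<close>

lemma solves_max_PiE:
  assumes "\<And>i. i \<in> I \<Longrightarrow> solves_max (f i) (S i) (z i)"
  shows "solves_max (\<lambda>x. \<Sum>i\<in>I. f i (x i)) (\<Pi>\<^sub>E i\<in>I. S i) (restrict z I)"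
  using assms by (auto simp: solves_max_iff PiE_iff intro!: sum_mono)

lemma dot_unit_vec:
  assumes "j \<in> {1..m}"
  shows "dot m w (unit_vec m j) = w j"
proof -
  have "dot m w (unit_vec m j) = (\<Sum>l\<in>{1..m}. if l = j then w l else 0)"
    unfolding dot_def unit_vec_def by (rule sum.cong) auto
  then show ?thesis
    using assms by simp
qed

lemma unit_vec_in_choice_set:
  assumes "j \<in> {1..m}"
  shows "unit_vec m j \<in> choice_set m"
  \<comment> \<open>The scalar product with the all-ones vector is the sum of the entries, so this
    instance gives the sum condition.\<close>
  using assms dot_unit_vec[OF assms, of "\<lambda>_. 1"]
  by (auto simp: choice_set_def vecs_def dot_def unit_vec_def)

lemma unit_vec_solves_max:
  assumes "j \<in> {1..m}" and "\<And>l. l \<in> {1..m} \<Longrightarrow> w l \<le> w j"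
  shows "solves_max (dot m w) (choice_set m) (unit_vec m j)"
  unfolding solves_max_iff
proof (intro conjI ballI)
  fix x assume x: "x \<in> choice_set m"
  then have "0 \<le> x l" if "l \<in> {1..m}" for l
    using that by (force simp: choice_set_def)
  \<comment> \<open>Nonnegative entries allow each weight \<open>w l\<close> to be raised to
    \<open>w j\<close>; factoring out \<open>w j\<close> then leaves the entry sum, which is
    1.\<close>
  then have "dot m w x \<le> (\<Sum>l\<in>{1..m}. w j * x l)"
    unfolding dot_def by (intro sum_mono mult_right_mono assms(2))
  also have "\<dots> = w j"
    using x by (simp add: choice_set_def flip: sum_distrib_left)
  finally show "dot m w x \<le> dot m w (unit_vec m j)"
    using assms(1) by (simp add: dot_unit_vec)
qed (rule unit_vec_in_choice_set[OF assms(1)])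

text \<open>Merges the two weighted criteria into one weight vector, the form that
  \<open>unit_vec_solves_max\<close> treats.\<close>

lemma dot_linear_left:
  "a * dot m u x + b * dot m v x = dot m (\<lambda>j. a * u j + b * v j) x"
  by (simp add: dot_def sum_distrib_left sum.distrib algebra_simps)

lemma block_dot_eq_sum_dot: "block_dot k n u x = (\<Sum>i\<in>{1..k}. dot (n i) (u i) (x i))"
  by (simp add: block_dot_def dot_def)

theorem proposition4p1:
  fixes k :: nat
    and n :: "nat \<Rightarrow> nat"
    and p c :: "nat \<Rightarrow> nat \<Rightarrow> real"
    and lam :: real
    and V :: "nat \<Rightarrow> real"
    and jstar :: "nat \<Rightarrow> nat"
    and xbar xstar
  assumes "k \<ge> 1"
    and "\<And>i. i \<in> {1..k} \<Longrightarrow> n i \<ge> 1"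
    and "p \<in> block_vecs k n"
    and "c \<in> block_vecs k n"
    and "\<And>i j. i \<in> {1..k} \<Longrightarrow> j \<in> {1..n i} \<Longrightarrow> p i j \<ge> 0"
    and "\<And>i j. i \<in> {1..k} \<Longrightarrow> j \<in> {1..n i} \<Longrightarrow> c i j \<ge> 0"
    and "0 < lam" and "lam < 1"
    and "\<And>i. i \<in> {1..k} \<Longrightarrow>
           V i = Max {lam * p i j + (1 - lam) * (- c i j) | j. 1 \<le> j \<and> j \<le> n i}"
    and "\<And>i. i \<in> {1..k} \<Longrightarrow> jstar i \<in> {1..n i}"
    and "\<And>i. i \<in> {1..k} \<Longrightarrow>
           V i = lam * p i (jstar i) + (1 - lam) * (- c i (jstar i))"
  defines "xbar \<equiv> \<lambda>i. unit_vec (n i) (jstar i)"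
    and "xstar \<equiv> \<lambda>i\<in>{1..k}. xbar i"
  shows "(\<forall>i\<in>{1..k}.
            solves_max (\<lambda>x. lam * dot (n i) (p i) x + (1 - lam) * dot (n i) (- c i) x)
              (choice_set (n i)) (xbar i))
       \<and> solves_max (\<lambda>x. lam * block_dot k n p x + (1 - lam) * block_dot k n (- c) x)
           (feasible_set k n) xstar"
proof -
  let ?f = "\<lambda>i x. lam * dot (n i) (p i) x + (1 - lam) * dot (n i) (- c i) x"
  have block: "solves_max (?f i) (choice_set (n i)) (xbar i)" if i: "i \<in> {1..k}" for i
  proof -
    let ?w = "\<lambda>j. lam * p i j + (1 - lam) * (- c i) j"
    have "?w l \<le> ?w (jstar i)" if "l \<in> {1..n i}" for l
    proof -
      have "?w l \<le> Max {lam * p i j + (1 - lam) * (- c i j) | j. 1 \<le> j \<and> j \<le> n i}"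
        \<comment> \<open>\<open>Max_ge\<close> also asks for finiteness, which holds since
          \<open>j\<close> ranges over a bounded set of naturals.\<close>
        using that by (intro Max_ge) auto
      then show ?thesis
        using assms(9)[OF i] assms(11)[OF i] by simp
    qed
    then show ?thesis
      unfolding xbar_def dot_linear_left by (intro unit_vec_solves_max assms(10) i)
  qed
  have "solves_max (\<lambda>x. \<Sum>i\<in>{1..k}. ?f i (x i)) (feasible_set k n) xstar"
    unfolding feasible_set_def xstar_def by (rule solves_max_PiE) (rule block)
  \<comment> \<open>Since \<open>(- c) i = - c i\<close>, pulling the two scalars out of the sum
    over blocks turns it into the objective on \<open>X\<close>.\<close>
  then show ?thesis
    using block by (simp add: block_dot_eq_sum_dot sum.distrib sum_distrib_left)
qed

end
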